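(* Let $N$ and $F$ be finite disjoint sets, and let $\Omega$ be a finite set of columns. Each column $l\in\Omega$ has a real cost $c_l$, coefficients $a_{ul}\in\{0,1\}$ for $u\in N$, and coefficients $a_{fl}\in\{0,1\}$ for $f\in F$ with exactly one $f\in F$ satisfying $a_{fl}=1$ (denoted $f_l$). For $\hat l\in\Omega$ let $\Omega_{\hat l}\subseteq\Omega$ be a set of columns (the family of $\hat l$) such that $\hat l\in\Omega_{\hat l}$ and every $l\in\Omega_{\hat l}$ satisfies $f_l=f_{\hat l}$ and $a_{ul}\le a_{u\hat l}$ for all $u\in N$. Let $\pi^+,\pi^-\in\mathbb{R}^N$ with $\pi^+_u\ge \pi^-_u$ for all $u\in N$. For $\hat\Omega\subseteq\Omega$ define $$\Psi_{\pi^+,\pi^-,\hat\Omega}=\sup\Big\{\sum_{u\in N}\pi_u-\sum_{f\in F}\pi_f \;:\; \pi\in\mathbb{R}_{\ge 0}^{N\cup F},\ c_l+\sum_{f\in F}a_{fl}\pi_f-\sum_{u\in N}a_{ul}\pi_u\ge 0\ \forall l\in\hat\Omega,\ \pi^+_u\ge\pi_u\ge\pi^-_u\ \forall u\in N\Big\}$$ (with the supremum of the empty set taken to be $-\infty$). Let $\Omega_R\subseteq\Omega$. For each $\hat l\in\Omega_R$ let $\hat l_{\pi^+}$ be any minimizer over $l\in\Omega_{\hat l}$ of $c_l+\sum_{f\in F}a_{fl}\pi_f-\sum_{u\in N}a_{ul}\pi^+_u$ (equivalently of $c_l-\sum_{u\in N}a_{ul}\pi^+_u$, since all members of $\Omega_{\hat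 l}$ share the same facility), and let $\Omega_{R\pi^+}=\{\hat l_{\pi^+}:\hat l\in\Omega_R\}$. Then $$\Psi_{\pi^+,\pi^-,\Omega_R}\ \ge\ \Psi_{\pi^+,\pi^-,\Omega_{R\pi^+}}.$$
   Context: This arises from column generation for set-cover type problems: $N$ is a set of items, $F$ a set of facilities, and a column $l$ covers the items $u$ with $a_{ul}=1$ using facility $f_l$. The family $\Omega_{\hat l}$ consists of columns whose item set is a subset of that of $\hat l$ and which preserve the structural properties of $\hat l$ (in particular its facility). $\Psi_{\pi^+,\pi^-,\hat\Omega}$ is the value of the dual restricted master LP over the columns $\hat\Omega$, with item dual variables restricted to the box $[\pi^-,\pi^+]$ and facility dual variables $\pi_f\ge 0$ otherwise unrestricted. *)

theory Defs
  imports Complex_Main "HOL-Library.Extended_Real"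
begin

text \<open>
  Items and facilities are disjoint sets \<open>N\<close>, \<open>F\<close> over one index type, so that a dual vector is a
  single function on \<open>N \<union> F\<close> and \<open>a i l\<close> is the coefficient of item or facility \<open>i\<close> in column \<open>l\<close>.
\<close>

definition facility :: "'i set \<Rightarrow> ('i \<Rightarrow> 'l \<Rightarrow> real) \<Rightarrow> 'l \<Rightarrow> 'i" where
  "facility F a l = (THE f. f \<in> F \<and> a f l = 1)"

text \<open>
  Facility duals \<open>\<rho>\<close> and item duals \<open>\<pi>\<close> are separate arguments: the dual constraints use one vector
  for both, while the minimizer over a family takes the item duals at their upper bounds.
\<close>

definition reduced_cost ::
  "'i set \<Rightarrow> 'i set \<Rightarrow> ('l \<Rightarrow> real) \<Rightarrow> ('i \<Rightarrow> 'l \<Rightarrow> real) \<Rightarrow> ('i \<Rightarrow> real) \<Rightarrow> ('i \<Rightarrow> real) \<Rightarrow> 'l \<Rightarrow> real"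
where
  "reduced_cost N F c a \<rho> \<pi> l = c l + (\<Sum>f\<in>F. a f l * \<rho> f) - (\<Sum>u\<in>N. a u l * \<pi> u)"

definition dual_feasible ::
  "'i set \<Rightarrow> 'i set \<Rightarrow> ('l \<Rightarrow> real) \<Rightarrow> ('i \<Rightarrow> 'l \<Rightarrow> real) \<Rightarrow>
   ('i \<Rightarrow> real) \<Rightarrow> ('i \<Rightarrow> real) \<Rightarrow> 'l set \<Rightarrow> ('i \<Rightarrow> real) set"
where
  "dual_feasible N F c a pplus pminus L =
     {\<pi>. (\<forall>i\<in>N \<union> F. 0 \<le> \<pi> i) \<and>
          (\<forall>l\<in>L. 0 \<le> reduced_cost N F c a \<pi> \<pi> l) \<and>
          (\<forall>u\<in>N. pminus u \<le> \<pi> u \<and> \<pi> u \<le> pplus u)}"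

text \<open>The supremum is taken in the extended reals, where \<open>Sup {} = -\<infinity>\<close>.\<close>

definition Psi ::
  "'i set \<Rightarrow> 'i set \<Rightarrow> ('l \<Rightarrow> real) \<Rightarrow> ('i \<Rightarrow> 'l \<Rightarrow> real) \<Rightarrow>
   ('i \<Rightarrow> real) \<Rightarrow> ('i \<Rightarrow> real) \<Rightarrow> 'l set \<Rightarrow> ereal"
where
  "Psi N F c a pplus pminus L =
     (SUP \<pi>\<in>dual_feasible N F c a pplus pminus L. ereal ((\<Sum>u\<in>N. \<pi> u) - (\<Sum>f\<in>F. \<pi> f)))"

end

theory Submission
  imports Defs
begin

text \<open>
  Every dual vector feasible for the columns \<open>m ` \<Omega>\<^sub>R\<close> is feasible for \<open>\<Omega>\<^sub>R\<close>. Lowering the item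
  duals from \<open>\<pi>\<^sup>+\<close> to \<open>\<pi>\<close> raises the reduced cost of a column by \<open>\<Sum>u. a\<^sub>u (\<pi>\<^sup>+\<^sub>u - \<pi>\<^sub>u)\<close>. This increase
  is largest for the column covering the most items, so the column \<open>lh\<close>, which at \<open>\<pi>\<^sup>+\<close> is no cheaper
  than the minimizer in its family, is no cheaper at \<open>\<pi>\<close> either.
\<close>

text \<open>Columns with a common facility thus contribute the same facility term to the reduced
  cost, for any facility duals.\<close>

lemma sum_facility_coeffs:
  fixes a :: "'i \<Rightarrow> 'l \<Rightarrow> real"
  assumes "finite F"
    and binary: "\<And>f. f \<in> F \<Longrightarrow> a f l \<in> {0, 1}"
    and unique: "\<exists>!f. f \<in> F \<and> a f l = 1"
  shows "(\<Sum>f\<in>F. a f l * \<rho> f) = \<rho> (facility F a l)"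
proof -
  have fac: "facility F a l \<in> F" "a (facility F a l) l = 1"
    using theI'[OF unique] unfolding facility_def by auto
  have "(\<Sum>f\<in>F. a f l * \<rho> f) = (\<Sum>f\<in>F. if f = facility F a l then \<rho> f else 0)"
  proof (rule sum.cong[OF refl])
    fix f assume "f \<in> F"
    then show "a f l * \<rho> f = (if f = facility F a l then \<rho> f else 0)"
      using binary[of f] unique fac by auto
  qed
  then show ?thesis
    using \<open>finite F\<close> fac by simp
qed

text \<open>The facility terms of \<open>l\<close> and \<open>k\<close> cancel in the comparison, so
  the facility duals may change freely from \<open>\<rho>\<close> to \<open>\<sigma>\<close>; only
  the item duals need a bound.\<close>

lemma reduced_cost_le_if_items_subset:
  assumes facilities: "\<And>\<sigma>. (\<Sum>f\<in>F. a f l * \<sigma> f) = (\<Sum>f\<in>F. a f k * \<sigma> f)"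
    and items: "\<And>u. u \<in> N \<Longrightarrow> a u l \<le> a u k"
    and upper: "\<And>u. u \<in> N \<Longrightarrow> \<pi> u \<le> pplus u"
    and le: "reduced_cost N F c a \<rho> pplus l \<le> reduced_cost N F c a \<rho> pplus k"
  shows "reduced_cost N F c a \<sigma> \<pi> l \<le> reduced_cost N F c a \<sigma> \<pi> k"
proof -
  \<comment> \<open>This sum is the growth of the gap between the reduced costs of \<open>k\<close>
    and \<open>l\<close> as the item duals drop from \<open>pplus\<close> to
    \<open>\<pi>\<close>.\<close>
  have "0 \<le> (\<Sum>u\<in>N. (a u k - a u l) * (pplus u - \<pi> u))"
    using items upper by (intro sum_nonneg mult_nonneg_nonneg) auto
  also have "\<dots> = (\<Sum>u\<in>N. a u k * pplus u) - (\<Sum>u\<in>N. a u l * pplus u)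
      - (\<Sum>u\<in>N. a u k * \<pi> u) + (\<Sum>u\<in>N. a u l * \<pi> u)"
    by (simp add: algebra_simps sum.distrib sum_subtractf)
  finally show ?thesis
    using le facilities[of \<rho>] facilities[of \<sigma>] unfolding reduced_cost_def by linarith
qed

theorem theorem1:
  fixes N F :: "'i set"
    and \<Omega> \<Omega>\<^sub>R :: "'l set"
    and c :: "'l \<Rightarrow> real"
    and a :: "'i \<Rightarrow> 'l \<Rightarrow> real"
    and fam :: "'l \<Rightarrow> 'l set"
    and pplus pminus \<rho> :: "'i \<Rightarrow> real"
    and m :: "'l \<Rightarrow> 'l"
  assumes "finite N" and "finite F" and "N \<inter> F = {}" and "finite \<Omega>"
    and "\<And>i l. i \<in> N \<union> F \<Longrightarrow> l \<in> \<Omega> \<Longrightarrow> a i l \<in> {0, 1}"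
    and "\<And>l. l \<in> \<Omega> \<Longrightarrow> \<exists>!f. f \<in> F \<and> a f l = 1"
    and "\<And>lh. lh \<in> \<Omega> \<Longrightarrow> fam lh \<subseteq> \<Omega>"
    and "\<And>lh. lh \<in> \<Omega> \<Longrightarrow> lh \<in> fam lh"
    and "\<And>lh l. lh \<in> \<Omega> \<Longrightarrow> l \<in> fam lh \<Longrightarrow> facility F a l = facility F a lh"
    and "\<And>lh l u. lh \<in> \<Omega> \<Longrightarrow> l \<in> fam lh \<Longrightarrow> u \<in> N \<Longrightarrow> a u l \<le> a u lh"
    and "\<And>u. u \<in> N \<Longrightarrow> pminus u \<le> pplus u"
    and "\<Omega>\<^sub>R \<subseteq> \<Omega>"
    and "\<And>lh. lh \<in> \<Omega>\<^sub>R \<Longrightarrow> is_arg_min (reduced_cost N F c a \<rho> pplus) (\<lambda>l. l \<in> fam lh) (m lh)"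
  shows "Psi N F c a pplus pminus \<Omega>\<^sub>R \<ge> Psi N F c a pplus pminus (m ` \<Omega>\<^sub>R)"
proof -
  have rc_le: "reduced_cost N F c a \<pi> \<pi> (m lh) \<le> reduced_cost N F c a \<pi> \<pi> lh"
    if lh: "lh \<in> \<Omega>\<^sub>R" and upper: "\<And>u. u \<in> N \<Longrightarrow> \<pi> u \<le> pplus u" for lh \<pi>
  proof (rule reduced_cost_le_if_items_subset[OF _ _ upper])
    have "lh \<in> \<Omega>" using lh \<open>\<Omega>\<^sub>R \<subseteq> \<Omega>\<close> by blast
    have "m lh \<in> fam lh" using assms(13)[OF lh] by (simp add: is_arg_min_def)
    then have "m lh \<in> \<Omega>" using assms(7)[OF \<open>lh \<in> \<Omega>\<close>] by blast
    have facility_sum: "(\<Sum>f\<in>F. a f l * \<sigma> f) = \<sigma> (facility F a l)" if "l \<in> \<Omega>" for l \<sigma>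
      using that assms(5,6) by (intro sum_facility_coeffs[OF \<open>finite F\<close>]) auto
    show "(\<Sum>f\<in>F. a f (m lh) * \<sigma> f) = (\<Sum>f\<in>F. a f lh * \<sigma> f)" for \<sigma>
      using facility_sum \<open>m lh \<in> \<Omega>\<close> \<open>lh \<in> \<Omega>\<close> assms(9)[OF \<open>lh \<in> \<Omega>\<close> \<open>m lh \<in> fam lh\<close>] by simp
    show "a u (m lh) \<le> a u lh" if "u \<in> N" for u
      using assms(10) \<open>lh \<in> \<Omega>\<close> \<open>m lh \<in> fam lh\<close> that .
    \<comment> \<open>Since \<open>lh\<close> lies in its own family, it is itself a competitor of
      the minimizer.\<close>
    show "reduced_cost N F c a \<rho> pplus (m lh) \<le> reduced_cost N F c a \<rho> pplus lh"
      using assms(13)[OF lh] assms(8)[OF \<open>lh \<in> \<Omega>\<close>] by (auto simp: is_arg_min_linorder)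
  qed
  \<comment> \<open>Sign and box constraints agree on both sides; the constraint of
    \<open>lh\<close> follows from that of \<open>m lh\<close>.\<close>
  have "dual_feasible N F c a pplus pminus (m ` \<Omega>\<^sub>R) \<subseteq> dual_feasible N F c a pplus pminus \<Omega>\<^sub>R"
    unfolding dual_feasible_def using rc_le by (auto intro: order_trans)
  \<comment> \<open>In the complete lattice \<open>ereal\<close>, monotonicity of the supremum also
    covers an empty feasible set.\<close>
  then show ?thesis
    unfolding Psi_def by (rule SUP_subset_mono) simp
qed

end
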